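(* Let $a$ and $b$ be coprime integers greater than two, let $T(a,b)$ be the torus knot of type $(a,b)$, and let $J_N(T(a,b);q)$ be its $N$-dimensional colored Jones polynomial. Then $$J_N\left(T(a,b);\exp\left(\frac{2\pi\sqrt{-1}}{abN}\right)\right)\underset{N\to\infty}{\sim}e^{-\frac{\pi\sqrt{-1}}{4}}\,\frac{\sin\left(\frac{\pi}{a}\right)\sin\left(\frac{\pi}{b}\right)}{\sqrt{2}\,\sin\left(\frac{\pi}{ab}\right)}\,N^{1/2}.$$
   Context: $A_N\underset{N\to\infty}{\sim}B_N$ means $\lim_{N\to\infty}A_N/B_N=1$. $J_N(K;q)$ denotes the (0-framed) colored Jones polynomial of a knot $K$ associated with the $N$-dimensional irreducible representation of $sl(2;\mathbb{C})$, normalized so that $J_N(\text{unknot};q)=1$ and $J_2(K;q)$ is the Jones polynomial. For torus knots it is given explicitly (Morton's formula), which may be taken as its definition and fixes the chirality/variable convention, by $$J_N(T(a,b);q)=\frac{q^{-ab(N^2-1)/4}}{q^{N/2}-q^{-N/2}}\sum_{k=-(N-1)/2}^{(N-1)/2}q^{abk^2+bk}\left(q^{ak+1/2}-q^{-ak-1/2}\right),$$ where $k$ runs in steps of $1$ (through half-integers if $N$ is even); this is a Laurent polynomial in $q$. For $q=\exp(c/N)$, $q^{s}$ means $\exp(sc/N)$. *)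

theory Defs
  imports "HOL-Complex_Analysis.Complex_Analysis" "HOL-Library.Landau_Symbols"
begin

text \<open>
  The 0-framed colored Jones polynomial of the torus knot of type (a,b) for coprime a and b,
  with value 1 on the unknot, given by Morton's formula. The summation index k runs through
  -(N-1)/2, -(N-3)/2, ..., (N-1)/2, written here as k = j - (N-1)/2 with j < N.

  Fractional powers of q are principal ones. In particular, if q = exp (c/N) with
  -pi < Im (c/N) and Im (c/N) \<le> pi, then q powr s = exp (s c/N). For coprime a and b the
  value does not depend on the branch: after cancelling the denominator only integral powers
  of q remain, so the formula defines a Laurent polynomial in q. The expression below agrees
  with this Laurent polynomial at every nonzero q with q^N different from 1. At the N-th
  roots of unity, which are removable singularities of the quotient, it is 0 because division
  by zero is.
\<close>

definition colored_Jones_torus :: "int \<Rightarrow> int \<Rightarrow> nat \<Rightarrow> complex \<Rightarrow> complex" where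
  "colored_Jones_torus a b N q =
     q powr (- (of_int a * of_int b * ((of_nat N)\<^sup>2 - 1) / 4))
       / (q powr (of_nat N / 2) - q powr (- (of_nat N / 2)))
     * (\<Sum>j<N. let k = of_nat j - (of_nat N - 1) / 2 in
          q powr (of_int a * of_int b * k\<^sup>2 + of_int b * k)
            * (q powr (of_int a * k + 1 / 2) - q powr (- (of_int a * k) - 1 / 2)))"

end

theory Submission
  imports Defs "HOL-Probability.Distributions" "HOL-Real_Asymp.Real_Asymp"
begin

text \<open>
  Write e(x) = exp (2 pi i x). With k = s - N/2 and s = j + 1/2, the term q^(a b k^2) of Morton's
  formula equals e(k^2/N), which is e(s^2/N) up to a factor independent of j. The sum is therefore
  a quadratic exponential sum with the smooth weight f(k/N), where
  f(x) = e(x/a) (e(x/b) - e(-x/b)), up to a negligible error. The phase has stationary points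
  (modulo 1) at k = 0, where f vanishes, and at the two ends k = -N/2 and k = N/2. Folding the two
  ends together by j \<mapsto> N - 1 - j turns the sum into one over 0 < s < N/2 with weight
  H(x) = f(x - 1/2) + f(1/2 - x) satisfying H(1/2) = 0. For s up to R sqrt N it is a Riemann sum
  of H(0) times a Fresnel integral; the middle range is O(sqrt N / R) by the Kuzmin-Landau
  inequality and partial summation; the last R sqrt N terms are small because H(1/2) = 0. The
  leading coefficient comes from H(0) = -4 sin(pi/a) sin(pi/b).
\<close>

section \<open>The Fresnel integral over the half-line\<close>

lemma norm_cis_diff_le: "norm (cis x - cis y) \<le> \<bar>x - y\<bar>"
proof -
  have "cis x - cis y = cis y * (cis (x - y) - 1)"
    by (simp add: algebra_simps cis_mult)
  also have "cis (x - y) = exp (\<i> * of_real (x - y))"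
    by (rule cis_conv_exp)
  finally have eq: "cis x - cis y = cis y * (exp (\<i> * of_real (x - y)) - 1)" .
  have "norm (cis x - cis y) = 2 * \<bar>sin ((x - y) / 2)\<bar>"
    unfolding eq norm_mult norm_cis dist_exp_i_1 by simp
  also have "\<dots> \<le> 2 * \<bar>(x - y) / 2\<bar>"
    by (intro mult_left_mono abs_sin_x_le_abs_x) auto
  finally show ?thesis by simp
qed

text \<open>An entire primitive \<open>E\<close> of exp (- z^2) serves both directions: along the
  real axis it gives the Gaussian integral, and along the ray through 1 - i it gives the Fresnel
  integral. The two limits agree because \<open>E\<close> varies by at most 1 / R on the vertical
  segment joining the two rays.\<close>

lemma fresnel_primitive:
  obtains G :: "real \<Rightarrow> complex"
  where "\<And>x. (G has_vector_derivative cis (2 * pi * x\<^sup>2)) (at x)" "G 0 = 0"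
    "(G \<longlongrightarrow> cis (pi / 4) / of_real (2 * sqrt 2)) at_top"
proof -
  have "(\<lambda>z::complex. exp (- z\<^sup>2)) holomorphic_on UNIV"
    by (intro holomorphic_intros)
  then obtain E0 where E0: "\<And>z. (E0 has_field_derivative exp (- z\<^sup>2)) (at (z :: complex))"
    using holomorphic_convex_primitive'[of UNIV "\<lambda>z. exp (- z\<^sup>2)"] by auto
  define E where "E z = E0 z - E0 0" for z
  have E: "(E has_field_derivative exp (- z\<^sup>2)) (at z)" for z
    unfolding E_def by (auto intro!: derivative_eq_intros E0)
  have [simp]: "E 0 = 0" by (simp add: E_def)
  \<comment> \<open>Links the complex primitive to the Lebesgue integral, the form in which
    \<open>gaussian_moment_0\<close> provides the Gaussian value.\<close>
  have E_real: "E (of_real R) = of_real (LBINT x:{0..R}. exp (- x\<^sup>2))" if "R \<ge> 0" for R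
  proof -
    have "set_integrable lborel {0..R} (\<lambda>x. exp (- x\<^sup>2) :: real)"
      by (intro borel_integrable_atLeastAtMost' continuous_intros)
    then have "((\<lambda>x. exp (- x\<^sup>2) :: real) has_integral (LBINT x:{0..R}. exp (- x\<^sup>2))) {0..R}"
      using set_borel_integral_eq_integral[of "{0..R}" "\<lambda>x. exp (- x\<^sup>2) :: real"]
      by (simp add: has_integral_iff)
    then have "((\<lambda>x. of_real (exp (- x\<^sup>2)) :: complex) has_integral of_real (LBINT x:{0..R}. exp (- x\<^sup>2))) {0..R}"
      by (rule has_integral_of_real)
    moreover have "((\<lambda>x. of_real (exp (- x\<^sup>2)) :: complex) has_integral E (of_real R) - E (of_real 0)) {0..R}"
    proof (rule fundamental_theorem_of_calculus[OF that])
      fix x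
      have "((\<lambda>x. E (of_real x)) has_vector_derivative exp (- (of_real x)\<^sup>2)) (at x)"
        using field_vector_diff_chain_at[OF has_vector_derivative_of_real[OF DERIV_ident] E, of x]
        by (simp add: o_def)
      then show "((\<lambda>x. E (of_real x)) has_vector_derivative of_real (exp (- x\<^sup>2))) (at x within {0..R})"
        by (simp add: has_vector_derivative_at_within flip: exp_of_real)
    qed
    ultimately show ?thesis by (simp add: has_integral_unique)
  qed
  have "((\<lambda>R. LBINT x:{0..R}. exp (- x\<^sup>2) :: real) \<longlongrightarrow> (LBINT x:{0..}. exp (- x\<^sup>2))) at_top"
    using gaussian_moment_0 
    by (intro tendsto_set_lebesgue_integral_at_top) (auto simp: set_integrable_def has_bochner_integral_iff)
  moreover have "(LBINT x:{0..}. exp (- x\<^sup>2) :: real) = sqrt pi / 2"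
    using gaussian_moment_0 by (simp add: set_lebesgue_integral_def has_bochner_integral_iff)
  ultimately have "((\<lambda>R. of_real (LBINT x:{0..R}. exp (- x\<^sup>2)) :: complex) \<longlongrightarrow> of_real (sqrt pi / 2)) at_top"
    by (intro tendsto_of_real) simp
  then have lim1: "((\<lambda>R. E (of_real R)) \<longlongrightarrow> of_real (sqrt pi / 2)) at_top"
    by (rule Lim_transform_eventually) (auto intro!: eventually_mono[OF eventually_ge_at_top[of 0]] simp: E_real)
  (* On the segment from R to R - i R the integrand has norm exp (- (R^2 - y^2)) \<le> exp (- R (R - y)). *)
  have diag: "norm (E (of_real R * (1 - \<i>)) - E (of_real R)) \<le> 1 / R" if "R > 0" for R
  proof -
    let ?g = "\<lambda>y. E (of_real R - \<i> * of_real y)"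
    let ?p = "\<lambda>y. exp (- (R * (R - y))) / R"
    have g: "(?g has_vector_derivative - \<i> * exp (- (of_real R - \<i> * of_real y)\<^sup>2)) (at y)" for y
    proof -
      have "((\<lambda>y. of_real R - \<i> * of_real y) has_vector_derivative - \<i>) (at y)"
        by (auto intro!: derivative_eq_intros)
      from field_vector_diff_chain_at[OF this E] show ?thesis
        by (simp add: o_def)
    qed
    have p: "(?p has_vector_derivative exp (- (R * (R - y)))) (at y)" for y
      unfolding has_real_derivative_iff_has_vector_derivative[symmetric]
      using that by (auto intro!: derivative_eq_intros)
    \<comment> \<open>\<open>?p\<close> is a primitive of the majorant, so the bound integrates to
      (1 - exp (- R^2)) / R.\<close>
    have "norm (?g R - ?g 0) \<le> ?p R - ?p 0"
    proof (rule differentiable_bound_general[OF that _ _ g p])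
      show "continuous_on {0..R} ?g" 
        by (rule continuous_on_vector_derivative) (rule has_vector_derivative_at_within[OF g])
      show "continuous_on {0..R} ?p" 
        by (rule continuous_on_vector_derivative) (rule has_vector_derivative_at_within[OF p])
      fix y assume y: "0 < y" "y < R"
      have "norm (- \<i> * exp (- (of_real R - \<i> * of_real y)\<^sup>2)) = exp (- (R\<^sup>2 - y\<^sup>2))"
        by (simp add: norm_mult power2_eq_square)
      also have "R\<^sup>2 - y\<^sup>2 \<ge> R * (R - y)"
        using y by (simp add: power2_eq_square algebra_simps)
      then have "exp (- (R\<^sup>2 - y\<^sup>2)) \<le> exp (- (R * (R - y)))" by simp
      finally show "norm (- \<i> * exp (- (of_real R - \<i> * of_real y)\<^sup>2)) \<le> exp (- (R * (R - y)))" .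
    qed
    also have "\<dots> \<le> 1 / R" using that by (simp add: field_simps)
    finally show ?thesis by (simp add: algebra_simps)
  qed
  have "((\<lambda>R. E (of_real R * (1 - \<i>)) - E (of_real R)) \<longlongrightarrow> 0) at_top"
  proof (rule Lim_null_comparison)
    show "\<forall>\<^sub>F R in at_top. norm (E (of_real R * (1 - \<i>)) - E (of_real R)) \<le> 1 / R"
      using eventually_gt_at_top[of 0] by eventually_elim (rule diag)
    show "((\<lambda>R::real. 1 / R) \<longlongrightarrow> 0) at_top" by real_asymp
  qed
  from tendsto_add[OF this lim1]
  have lim2: "((\<lambda>R. E (of_real R * (1 - \<i>))) \<longlongrightarrow> of_real (sqrt pi / 2)) at_top"
    by simp
  \<comment> \<open>A square root of - 2 pi i on the ray through 1 - i: the substitution z = x w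
    turns exp (- z^2) into cis (2 pi x^2).\<close>
  define w where "w = of_real (sqrt pi) * (1 - \<i>)"
  have w0: "w \<noteq> 0" by (auto simp: w_def complex_eq_iff)
  have w2: "w\<^sup>2 = - 2 * of_real pi * \<i>"
    by (simp add: w_def power_mult_distrib power2_diff flip: of_real_power)
  define G where "G x = E (of_real x * w) / w" for x
  show ?thesis
  proof
    fix x
    have "((\<lambda>x. of_real x * w) has_vector_derivative w) (at x)"
      by (auto intro!: derivative_eq_intros)
    from field_vector_diff_chain_at[OF this E]
    have "((\<lambda>x. E (of_real x * w)) has_vector_derivative w * exp (- (of_real x * w)\<^sup>2)) (at x)"
      by (simp add: o_def)
    from has_vector_derivative_divide[OF this, of w]
    have "(G has_vector_derivative exp (- (of_real x * w)\<^sup>2)) (at x)"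
      using w0 by (simp add: G_def[abs_def])
    also have "exp (- (of_real x * w)\<^sup>2) = cis (2 * pi * x\<^sup>2)"
      by (simp add: power_mult_distrib w2 cis_conv_exp algebra_simps)
    finally show "(G has_vector_derivative cis (2 * pi * x\<^sup>2)) (at x)" .
  next
    show "G 0 = 0" by (simp add: G_def)
  next
    have "filterlim (\<lambda>x. sqrt pi * x) at_top at_top"
      by (rule filterlim_tendsto_pos_mult_at_top[OF tendsto_const _ filterlim_ident]) simp
    from filterlim_compose[OF lim2 this]
    have "(G \<longlongrightarrow> of_real (sqrt pi / 2) / w) at_top"
      unfolding G_def[abs_def] w_def by (intro tendsto_divide w0[unfolded w_def] tendsto_const) (simp add: mult_ac)
    also have "of_real (sqrt pi / 2) / w = cis (pi / 4) / of_real (2 * sqrt 2)"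
    proof -
      have "cis (pi / 4) = of_real (sqrt 2 / 2) * (1 + \<i>)"
        by (simp add: complex_eq_iff cos_45 sin_45)
      moreover have "of_real (sqrt pi / 2) / w = (1 + \<i>) / 4"
        by (simp add: w_def field_simps)
      ultimately show ?thesis by (simp only:) simp
    qed
    finally show "(G \<longlongrightarrow> cis (pi / 4) / of_real (2 * sqrt 2)) at_top" .
  qed
qed

section \<open>The Kuzmin-Landau inequality and summation by parts\<close>

lemma one_minus_cis: "1 - cis (2 * x) = - 2 * \<i> * of_real (sin x) * cis x"
proof (rule complex_eqI)
  have "cos (2 * x) = 1 - 2 * sin x * sin x"
    by (simp add: cos_double_sin power2_eq_square)
  then show "Re (1 - cis (2 * x)) = Re (- 2 * \<i> * of_real (sin x) * cis x)" by simp
qed (simp add: sin_double)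

text \<open>What matters is the constant real part 1/2: these values move on a vertical line, so
  their variation is half that of the cotangent.\<close>

lemma inverse_one_minus_cis:
  assumes "sin x \<noteq> 0"
  shows "1 / (1 - cis (2 * x)) = (1 + \<i> * of_real (cot x)) / 2"
proof -
  have "(1 + \<i> * of_real (cot x)) * of_real (sin x) = \<i> * cis (- x)"
    using assms by (simp add: complex_eq_iff cot_def)
  then have "(1 + \<i> * of_real (cot x)) * of_real (sin x) * (- 2 * \<i> * cis x) = 2"
    by (simp add: cis_mult algebra_simps)
  then have "(1 + \<i> * of_real (cot x)) * (1 - cis (2 * x)) = 2"
    unfolding one_minus_cis by (simp only: mult_ac)
  moreover from this have "1 - cis (2 * x) \<noteq> 0" by force
  ultimately show ?thesis by (subst frac_eq_eq) auto
qed

lemma cot_antimono: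
  assumes "0 < x" "x \<le> y" "y < pi"
  shows "cot y \<le> cot x"
proof -
  have "cot x - cot y = sin (y - x) / (sin x * sin y)"
    using assms sin_gt_zero[of x] sin_gt_zero[of y] by (simp add: cot_def sin_diff field_simps)
  also have "\<dots> \<ge> 0"
    using assms sin_gt_zero[of x] sin_gt_zero[of y] sin_ge_zero[of "y - x"] by simp
  finally show ?thesis by simp
qed

text \<open>Each term is a difference of consecutive terms times
  \<open>1 / (1 - cis (2 * (pi * \<theta> n)))\<close>. After summation by parts the increments of
  this factor telescope, because \<open>\<theta>\<close> is monotone, so the bound does not depend
  on the number of terms. The two boundary values contribute 1 / d together, the total variation
  another 1 / d.\<close>

lemma Kuzmin_Landau:
  fixes \<phi> :: "nat \<Rightarrow> real"
  defines "\<theta> \<equiv> \<lambda>n. \<phi> (Suc n) - \<phi> n"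
  assumes mono: "\<And>n. m \<le> n \<Longrightarrow> Suc n < M \<Longrightarrow> \<theta> n \<le> \<theta> (Suc n)"
    and "d > 0"
    and \<theta>: "\<And>n. m \<le> n \<Longrightarrow> n < M \<Longrightarrow> 0 < \<theta> n \<and> \<theta> n < 1 \<and> d \<le> sin (pi * \<theta> n)"
  shows "norm (\<Sum>n=m..<M. cis (2 * pi * \<phi> n)) \<le> 2 / d"
proof (cases "m < M")
  case False
  then show ?thesis using \<open>d > 0\<close> by simp
next
  case True
  define z where "z n = cis (2 * pi * \<phi> n)" for n
  define c where "c n = 1 / (1 - cis (2 * (pi * \<theta> n)))" for n
  have sin_pos: "sin (pi * \<theta> n) > 0" if "m \<le> n" "n < M" for n
    using \<theta>[OF that] \<open>d > 0\<close> by linarith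
  have c: "c n = (1 + \<i> * of_real (cot (pi * \<theta> n))) / 2" if "m \<le> n" "n < M" for n
    unfolding c_def using sin_pos[OF that] by (intro inverse_one_minus_cis) simp
  have norm_c: "norm (c n) \<le> 1 / (2 * d)" if "m \<le> n" "n < M" for n
    using \<theta>[OF that] \<open>d > 0\<close> sin_pos[OF that]
    by (simp add: c_def one_minus_cis norm_divide norm_mult divide_simps)
  have cot_le: "\<bar>cot (pi * \<theta> n)\<bar> \<le> 1 / d" if "m \<le> n" "n < M" for n
  proof -
    have "\<bar>cot (pi * \<theta> n)\<bar> / 2 = \<bar>Im (c n)\<bar>" by (simp add: c[OF that])
    also have "\<dots> \<le> norm (c n)" by (rule abs_Im_le_cmod)
    also have "\<dots> \<le> 1 / (2 * d)" by (rule norm_c[OF that])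
    finally show ?thesis by simp
  qed
  have twist: "z n = (z n - z (Suc n)) * c n" if "m \<le> n" "n < M" for n
  proof -
    have "z (Suc n) = z n * cis (2 * (pi * \<theta> n))"
      by (simp add: z_def \<theta>_def cis_mult algebra_simps)
    then have "z n - z (Suc n) = z n * (1 - cis (2 * (pi * \<theta> n)))"
      by (simp add: algebra_simps)
    moreover have "1 - cis (2 * (pi * \<theta> n)) \<noteq> 0"
      using sin_pos[OF that] by (simp add: one_minus_cis)
    ultimately show ?thesis by (simp add: c_def)
  qed
  (* Summing z n = (z n - z (Suc n)) * c n by parts; since the real part of c is constant, the
     increments of c are those of the cotangent, which telescope in norm by monotonicity. *)
  have main: "norm ((\<Sum>n=m..<Suc k. z n) + z (Suc k) * c k)
      \<le> norm (c m) + (cot (pi * \<theta> m) - cot (pi * \<theta> k)) / 2" if "m \<le> k" "k < M" for k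
    using that
  proof (induction k rule: dec_induct)
    case base
    have "z m + z (Suc m) * c m = z m * c m"
      using twist[of m] True by (simp add: algebra_simps)
    then show ?case by (simp add: norm_mult z_def)
  next
    case (step k)
    have "z (Suc k) + z (Suc (Suc k)) * c (Suc k) = z (Suc k) * c (Suc k)"
      using twist[of "Suc k"] step by (simp add: algebra_simps)
    then have "(\<Sum>n=m..<Suc (Suc k). z n) + z (Suc (Suc k)) * c (Suc k)
        = ((\<Sum>n=m..<Suc k. z n) + z (Suc k) * c k) + z (Suc k) * (c (Suc k) - c k)"
      using step by (simp add: algebra_simps)
    also have "norm \<dots> \<le> norm ((\<Sum>n=m..<Suc k. z n) + z (Suc k) * c k) + norm (c (Suc k) - c k)"
      by (rule order_trans[OF norm_triangle_ineq]) (simp add: norm_mult z_def)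
    also have "norm (c (Suc k) - c k) = (cot (pi * \<theta> k) - cot (pi * \<theta> (Suc k))) / 2"
    proof -
      have "c (Suc k) - c k = \<i> * of_real ((cot (pi * \<theta> (Suc k)) - cot (pi * \<theta> k)) / 2)"
        using step by (simp add: c field_simps)
      moreover have "cot (pi * \<theta> (Suc k)) \<le> cot (pi * \<theta> k)"
        using \<theta>[of k] \<theta>[of "Suc k"] mono[of k] step
        by (intro cot_antimono) auto
      ultimately show ?thesis by (simp only: norm_mult norm_ii norm_of_real) simp
    qed
    finally show ?case using step.IH[OF Suc_lessD[OF step.prems]] by argo
  qed
  \<comment> \<open>The boundary term at the last index \<open>k\<close> involves
    \<open>z (Suc k)\<close>, that is \<open>z M\<close>, one index past the sum.\<close>
  obtain k where k: "M = Suc k" "m \<le> k" using True by (cases M) auto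
  have "(\<Sum>n=m..<M. z n) = ((\<Sum>n=m..<Suc k. z n) + z (Suc k) * c k) - z (Suc k) * c k"
    by (simp add: k)
  also have "norm \<dots> \<le> norm (c m) + (cot (pi * \<theta> m) - cot (pi * \<theta> k)) / 2 + norm (c k)"
    using main[of k] k by (intro order_trans[OF norm_triangle_ineq4]) (simp add: norm_mult z_def)
  also have "\<dots> \<le> 1 / (2 * d) + (1 / d + 1 / d) / 2 + 1 / (2 * d)"
    using norm_c[of m] norm_c[of k] cot_le[of m] cot_le[of k] k by (intro add_mono) auto
  also have "\<dots> = 2 / d" using \<open>d > 0\<close> by (simp add: field_simps)
  finally show ?thesis by (simp add: z_def)
qed

text \<open>Abel summation by induction on the upper end \<open>k\<close>: the difference between
  the weighted sum and the boundary term \<open>U k * h k\<close> changes by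
  \<open>U (Suc k) * (h k - h (Suc k))\<close> in each step. The boundary weight \<open>h M\<close>
  lies one index past the sum.\<close>

lemma norm_summation_by_parts_le:
  fixes z h :: "nat \<Rightarrow> 'a :: real_normed_algebra"
  assumes "m \<le> M"
    and B: "\<And>n. m \<le> n \<Longrightarrow> n \<le> M \<Longrightarrow> norm (\<Sum>j=m..<n. z j) \<le> B"
    and D: "\<And>n. m \<le> n \<Longrightarrow> n < M \<Longrightarrow> norm (h n - h (Suc n)) \<le> D"
  shows "norm (\<Sum>n=m..<M. z n * h n) \<le> B * (norm (h M) + (real M - real m) * D)"
proof -
  define U where "U n = (\<Sum>j=m..<n. z j)" for n
  have B0: "B \<ge> 0" using B[of m] assms(1) by simp
  have "norm ((\<Sum>n=m..<k. z n * h n) - U k * h k) \<le> B * ((real k - real m) * D)"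
    if "m \<le> k" "k \<le> M" for k
    using that
  proof (induction k rule: dec_induct)
    case base
    show ?case by (simp add: U_def)
  next
    case (step k)
    have "(\<Sum>n=m..<Suc k. z n * h n) - U (Suc k) * h (Suc k)
        = ((\<Sum>n=m..<k. z n * h n) - U k * h k) + U (Suc k) * (h k - h (Suc k))"
      using step by (simp add: U_def algebra_simps)
    also have "norm \<dots> \<le> B * ((real k - real m) * D) + B * D"
      using step B[of "Suc k"] D[of k] B0
      by (intro order_trans[OF norm_triangle_ineq] add_mono order_trans[OF norm_mult_ineq] mult_mono)
        (auto simp: U_def)
    finally show ?case by (simp add: algebra_simps)
  qed
  from this[of M] have "norm ((\<Sum>n=m..<M. z n * h n) - U M * h M) \<le> B * ((real M - real m) * D)"
    using assms by simp
  moreover have "norm (U M * h M) \<le> B * norm (h M)"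
    using B[of M] assms(1) by (intro order_trans[OF norm_mult_ineq] mult_right_mono) (auto simp: U_def)
  ultimately show ?thesis
    using norm_triangle_ineq[of "(\<Sum>n=m..<M. z n * h n) - U M * h M" "U M * h M"]
    by (simp add: algebra_simps)
qed

section \<open>Quadratic exponential sums with a Lipschitz weight\<close>

text \<open>On [0, T] the integrand has Lipschitz constant 4 pi T. A cell of length h therefore
  costs at most 4 pi T h^2, and the m cells have total length at most T.\<close>

lemma fresnel_midpoint_sum:
  fixes G :: "real \<Rightarrow> complex"
  assumes G: "\<And>x. (G has_vector_derivative cis (2 * pi * x\<^sup>2)) (at x)" and "G 0 = 0"
    and h: "h \<ge> 0" "real m * h \<le> T"
  shows "norm (of_real h * (\<Sum>n<m. cis (2 * pi * ((real n + 1/2) * h)\<^sup>2)) - G (real m * h))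
    \<le> 4 * pi * T\<^sup>2 * h"
proof -
  have T: "T \<ge> 0" using h by (meson mult_nonneg_nonneg of_nat_0_le_iff order_trans)
  define g where "g x = cis (2 * pi * x\<^sup>2)" for x
  have lip: "norm (g x - g y) \<le> 4 * pi * T * h" if "x \<in> {0..T}" "y \<in> {0..T}" "\<bar>x - y\<bar> \<le> h" for x y
  proof -
    have "norm (g x - g y) \<le> \<bar>2 * pi * x\<^sup>2 - 2 * pi * y\<^sup>2\<bar>"
      unfolding g_def by (rule norm_cis_diff_le)
    also have "2 * pi * x\<^sup>2 - 2 * pi * y\<^sup>2 = 2 * pi * ((x + y) * (x - y))"
      by (simp add: power2_eq_square algebra_simps)
    also have "\<bar>\<dots>\<bar> = 2 * pi * (\<bar>x + y\<bar> * \<bar>x - y\<bar>)"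
      by (simp add: abs_mult)
    also have "\<dots> \<le> 2 * pi * ((2 * T) * h)"
      using that T by (intro mult_left_mono mult_mono) auto
    finally show ?thesis by (simp add: algebra_simps)
  qed
  have cell: "norm (of_real h * g ((real n + 1/2) * h) - (G (real (Suc n) * h) - G (real n * h)))
      \<le> 4 * pi * T * h * h" if "n < m" for n
  proof -
    let ?c = "(real n + 1/2) * h"
    have Tn: "real (Suc n) * h \<le> T"
      using h that by (intro order_trans[OF mult_right_mono h(2)]) auto
    \<comment> \<open>Subtracting a linear function of slope \<open>g ?c\<close> makes the error of
      the cell an increment of \<open>?F\<close>, whose derivative \<open>g x - g ?c\<close> is
      small.\<close>
    let ?F = "\<lambda>x. G x - of_real x * g ?c"
    have "norm (?F (real (Suc n) * h) - ?F (real n * h)) \<le> 4 * pi * T * h * norm (real (Suc n) * h - real n * h)"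
    proof (rule differentiable_bound[of "{real n * h..real (Suc n) * h}" ?F "\<lambda>x d. of_real d * (g x - g ?c)"])
      fix x assume x: "x \<in> {real n * h..real (Suc n) * h}"
      have "(?F has_vector_derivative g x - g ?c) (at x)"
        by (auto intro!: derivative_eq_intros G simp: g_def)
      then show "(?F has_derivative (\<lambda>d. of_real d * (g x - g ?c))) (at x within {real n * h..real (Suc n) * h})"
        by (simp add: has_vector_derivative_def has_derivative_at_withinI scaleR_conv_of_real)
      have "norm (g x - g ?c) \<le> 4 * pi * T * h"
      proof (rule lip)
        show "x \<in> {0..T}" using x Tn h by (auto intro: order_trans[rotated])
        show "?c \<in> {0..T}" using Tn h by (auto simp: algebra_simps)
        show "\<bar>x - ?c\<bar> \<le> h" using x h by (auto simp: algebra_simps abs_le_iff)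
      qed
      then show "onorm (\<lambda>d. of_real d * (g x - g ?c)) \<le> 4 * pi * T * h"
        using T h(1) by (intro onorm_bound) (auto simp: norm_mult mult.commute intro: mult_left_mono)
    qed (use h in \<open>auto intro: mult_right_mono\<close>)
    then show ?thesis using h by (simp add: algebra_simps norm_minus_commute)
  qed
  have "(\<Sum>n<m. G (real (Suc n) * h) - G (real n * h)) = G (real m * h)"
    using sum_lessThan_telescope[of "\<lambda>n. G (real n * h)" m] \<open>G 0 = 0\<close> by simp
  then have "of_real h * (\<Sum>n<m. g ((real n + 1/2) * h)) - G (real m * h)
     = (\<Sum>n<m. of_real h * g ((real n + 1/2) * h) - (G (real (Suc n) * h) - G (real n * h)))"
    by (simp only: sum_subtractf sum_distrib_left)
  also have "norm \<dots> \<le> (\<Sum>n<m. 4 * pi * T * h * h)"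
    by (intro sum_norm_le cell) simp
  also have "\<dots> = (real m * h) * (4 * pi * T * h)" by simp
  also have "\<dots> \<le> T * (4 * pi * T * h)"
    using h T by (intro mult_right_mono) auto
  finally show ?thesis by (simp add: g_def power2_eq_square algebra_simps)
qed

text \<open>Jordan's inequality: by concavity the sine lies above its chord over [0, pi/2].\<close>

lemma sin_pi_times_ge:
  assumes "0 \<le> t" "t \<le> 1 / 2"
  shows "sin (pi * t) \<ge> 2 * t"
proof -
  have concave: "concave_on {0..pi} sin"
  proof (rule f''_le0_imp_concave)
    fix x :: real assume "x \<in> {0..pi}"
    then show "- sin x \<le> 0" using sin_ge_zero[of x] by simp
  qed (auto intro!: derivative_eq_intros)
  have "(1 - 2 * t) * sin 0 + 2 * t * sin (pi / 2) \<le> sin ((1 - 2 * t) *\<^sub>R 0 + (2 * t) *\<^sub>R (pi / 2))"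
    using assms by (intro concave_onD[OF concave]) auto
  then show ?thesis by (simp add: mult.commute)
qed

text \<open>Provides the lower bound on the sine that \<open>Kuzmin_Landau\<close> requires when the
  phase differences keep distance \<open>\<delta>\<close> from 0 and 1.\<close>

lemma sin_pi_times_ge':
  assumes "0 \<le> \<delta>" "\<delta> \<le> t" "t \<le> 1 - \<delta>"
  shows "sin (pi * t) \<ge> 2 * \<delta>"
proof (cases "t \<le> 1 / 2")
  case True
  then show ?thesis using sin_pi_times_ge[of t] assms by simp
next
  case False
  have "sin (pi * t) = sin (pi * (1 - t))"
    by (simp add: right_diff_distrib sin_diff)
  then show ?thesis using sin_pi_times_ge[of "1 - t"] assms False by simp
qed

text \<open>The three error terms have separate sources: the Riemann sum over the first m terms; the
  variation of \<open>H\<close> away from \<open>H 0\<close> on the first m terms and away from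
  \<open>H (1/2) = 0\<close> on the last m terms; and the oscillating middle range.\<close>

lemma quadratic_sum_split_bound:
  fixes H :: "real \<Rightarrow> complex" and N m P :: nat and G :: "real \<Rightarrow> complex"
  assumes lip: "\<And>x y. x \<in> {0..1/2} \<Longrightarrow> y \<in> {0..1/2} \<Longrightarrow> norm (H x - H y) \<le> L * \<bar>x - y\<bar>"
    and H_half: "H (1/2) = 0"
    and G: "\<And>x. (G has_vector_derivative cis (2 * pi * x\<^sup>2)) (at x)" and G0: "G 0 = 0"
    and m: "0 < m" "2 * m \<le> P" "P = N div 2"
    and h: "h = 1 / sqrt (real N)" "real m * h \<le> T"
  shows "norm (of_real h * (\<Sum>n<P. cis (2 * pi * ((real n + 1/2)\<^sup>2 / N)) * H ((real n + 1/2) / N)) - H 0 * G (real m * h))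
     \<le> norm (H 0) * (4 * pi * T\<^sup>2 * h) + 2 * (L * T\<^sup>2 * h) + L / (2 * (real m * h))"
proof -
  define z where "z n = cis (2 * pi * ((real n + 1/2)\<^sup>2 / N))" for n
  define s where "s n = (real n + 1/2) / N" for n
  define M where "M = P - m"
  have mM: "m \<le> M" "M \<le> P" "M + m = P" using m by (auto simp: M_def)
  have N: "real N \<ge> 4" using m by linarith
  have P: "2 * real P \<le> real N" "real N \<le> 2 * real P + 1" using m by linarith+
  have h0: "h > 0" and hh: "h * h = 1 / N" using N by (simp_all add: h)
  have T0: "T \<ge> 0" using h(2) h0 by (meson less_imp_le mult_nonneg_nonneg of_nat_0_le_iff order_trans)
  have L0: "L \<ge> 0" using order_trans[OF norm_ge_zero lip[of 0 "1/2"]] by simp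
  have norm_z [simp]: "norm (z n) = 1" for n by (simp add: z_def)
  have s_mem: "s n \<in> {0..1/2}" if "n < P" for n
    using that P N by (simp add: s_def field_simps)
  have mh: "(real m * h) * (real m * h) \<le> T * T"
    using h h0 T0 by (intro mult_mono) auto
  \<comment> \<open>The trivial bound for an end block, m terms of size at most L m / N, expressed
    through T by means of h^2 = 1 / N.\<close>
  have m2: "real m * (L * (real m / N)) * h \<le> L * T\<^sup>2 * h"
  proof -
    have "real m * (L * (real m / N)) * h = L * h * (real m * real m * (h * h))"
      by (simp add: hh)
    also have "\<dots> = L * h * ((real m * h) * (real m * h))" by (simp add: mult_ac)
    also have "\<dots> \<le> L * h * (T * T)" using L0 h0 mh by (intro mult_left_mono) auto
    finally show ?thesis by (simp add: power2_eq_square mult_ac)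
  qed
  have start: "norm (\<Sum>n<m. z n * (H (s n) - H 0)) \<le> real m * (L * (real m / N))"
  proof -
    have "norm (z n * (H (s n) - H 0)) \<le> L * (real m / N)" if "n < m" for n
    proof -
      have "norm (H (s n) - H 0) \<le> L * \<bar>s n - 0\<bar>"
        using that m by (intro lip s_mem) auto
      also have "\<bar>s n - 0\<bar> \<le> real m / N"
        using that N by (simp add: s_def divide_right_mono)
      finally show ?thesis using L0 by (simp add: norm_mult mult_left_mono)
    qed
    then have "norm (\<Sum>n<m. z n * (H (s n) - H 0)) \<le> (\<Sum>n<m. L * (real m / N))"
      by (intro sum_norm_le) simp
    then show ?thesis by simp
  qed
  have last: "norm (\<Sum>n=M..<P. z n * H (s n)) \<le> real m * (L * (real m / N))"
  proof -
    have "norm (z n * H (s n)) \<le> L * (real m / N)" if "n \<in> {M..<P}" for n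
    proof -
      have "norm (H (s n) - H (1/2)) \<le> L * \<bar>s n - 1/2\<bar>"
        using that by (intro lip s_mem) auto
      also have "\<bar>s n - 1/2\<bar> \<le> real m / N"
      proof -
        have "1/2 - s n = (real N / 2 - real n - 1/2) / N"
          using N by (simp add: s_def field_simps)
        also have "\<dots> \<le> real m / N"
          using that P mM N by (intro divide_right_mono) auto
        finally show ?thesis using s_mem[of n] that by simp
      qed
      finally show ?thesis using L0 H_half by (simp add: norm_mult mult_left_mono)
    qed
    then have "norm (\<Sum>n=M..<P. z n * H (s n)) \<le> (\<Sum>n=M..<P. L * (real m / N))"
      by (intro sum_norm_le) simp
    also have "\<dots> = real m * (L * (real m / N))" using mM by simp
    finally show ?thesis .
  qed
  \<comment> \<open>The phase differences 2 (j + 1) / N stay at distance at least 2 m / N from 0 and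
    1 in the middle range, so \<open>Kuzmin_Landau\<close> applies with d = 4 m / N.\<close>
  have KL: "norm (\<Sum>j=m..<n. z j) \<le> N / (2 * real m)" if "m \<le> n" "n \<le> M" for n
  proof -
    have diff: "(real (Suc j) + 1/2)\<^sup>2 / N - (real j + 1/2)\<^sup>2 / N = 2 * (real j + 1) / N" for j
      by (simp add: power2_eq_square algebra_simps flip: diff_divide_distrib)
    have "norm (\<Sum>j=m..<n. cis (2 * pi * ((real j + 1/2)\<^sup>2 / N))) \<le> 2 / (2 * (2 * real m / N))"
    proof (rule Kuzmin_Landau[where \<phi> = "\<lambda>j. (real j + 1/2)\<^sup>2 / N"]; (unfold diff)?)
      fix j assume j: "m \<le> j" "j < n"
      have 1: "2 * real m / N \<le> 2 * (real j + 1) / N"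
        using j N by (intro divide_right_mono) auto
      have "2 * (real j + 1) / N \<le> (real N - 2 * real m) / N"
        using j that mM P N by (intro divide_right_mono) auto
      also have "\<dots> = 1 - 2 * real m / N" using N by (simp add: field_simps)
      finally have 2: "2 * (real j + 1) / N \<le> 1 - 2 * real m / N" .
      have 3: "2 * real m / N > 0" using m N by simp
      show "0 < 2 * (real j + 1) / N \<and> 2 * (real j + 1) / N < 1 \<and>
          2 * (2 * real m / N) \<le> sin (pi * (2 * (real j + 1) / N))"
        using 1 2 3 sin_pi_times_ge'[OF _ 1 2] by linarith
    qed (use m N in \<open>auto intro!: divide_right_mono\<close>)
    then show ?thesis using m N by (simp add: z_def field_simps)
  qed
  have mid: "norm (\<Sum>n=m..<M. z n * H (s n)) \<le> N / (2 * real m) * L"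
  proof -
    have "norm (\<Sum>n=m..<M. z n * H (s n)) \<le> N / (2 * real m) * (norm (H (s M)) + (real M - real m) * (L / N))"
    proof (rule norm_summation_by_parts_le[OF mM(1) KL])
      fix n assume n: "m \<le> n" "n < M"
      have "norm (H (s n) - H (s (Suc n))) \<le> L * \<bar>s n - s (Suc n)\<bar>"
        using n mM m by (intro lip s_mem) auto
      also have "s n - s (Suc n) = - (1 / N)"
        using N by (simp add: s_def field_simps)
      finally show "norm (H (s n) - H (s (Suc n))) \<le> L / N" using N by simp
    qed
    \<comment> \<open>The end value is at most L / 2 since \<open>H\<close> vanishes at 1/2; at most
      N / 2 increments of size L / N give the other half.\<close>
    also have "norm (H (s M)) + (real M - real m) * (L / N) \<le> L"
    proof -
      have "norm (H (s M) - H (1/2)) \<le> L * \<bar>s M - 1/2\<bar>"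
        using mM m by (intro lip s_mem) auto
      also have "\<dots> \<le> L * (1/2)" using s_mem[of M] mM m L0 by (intro mult_left_mono) auto
      finally have 1: "norm (H (s M)) \<le> L / 2" using H_half by simp
      have "(real M - real m) * (L / N) \<le> (real N / 2) * (L / N)"
        using mM P L0 N by (intro mult_right_mono) auto
      also have "\<dots> = L / 2" using N by simp
      finally show ?thesis using 1 by argo
    qed
    finally show ?thesis using m N by (simp add: mult_left_mono divide_right_mono)
  qed
  have head: "norm (of_real h * (\<Sum>n<m. z n) - G (real m * h)) \<le> 4 * pi * T\<^sup>2 * h"
  proof -
    have "z n = cis (2 * pi * ((real n + 1/2) * h)\<^sup>2)" for n
      using hh by (simp add: z_def power_mult_distrib power2_eq_square[of h])
    then show ?thesis
      using fresnel_midpoint_sum[OF G G0 less_imp_le[OF h0] h(2)] by simp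
  qed
  have "(\<Sum>n<P. z n * H (s n)) = (\<Sum>n<m. z n * H (s n)) + (\<Sum>n=m..<M. z n * H (s n)) + (\<Sum>n=M..<P. z n * H (s n))"
    using mM by (simp add: lessThan_atLeast0 sum.atLeastLessThan_concat)
  also have "(\<Sum>n<m. z n * H (s n)) = H 0 * (\<Sum>n<m. z n) + (\<Sum>n<m. z n * (H (s n) - H 0))"
    by (simp add: sum_distrib_left algebra_simps flip: sum.distrib)
  finally have "of_real h * (\<Sum>n<P. z n * H (s n)) - H 0 * G (real m * h)
    = H 0 * (of_real h * (\<Sum>n<m. z n) - G (real m * h))
      + of_real h * ((\<Sum>n<m. z n * (H (s n) - H 0)) + (\<Sum>n=M..<P. z n * H (s n)))
      + of_real h * (\<Sum>n=m..<M. z n * H (s n))"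
    by (simp add: algebra_simps)
  also have "norm \<dots> \<le> norm (H 0) * (4 * pi * T\<^sup>2 * h)
      + h * (real m * (L * (real m / N)) + real m * (L * (real m / N)))
      + h * (N / (2 * real m) * L)"
  proof (intro order_trans[OF norm_triangle_ineq] add_mono)
    show "norm (H 0 * (of_real h * (\<Sum>n<m. z n) - G (real m * h))) \<le> norm (H 0) * (4 * pi * T\<^sup>2 * h)"
      unfolding norm_mult by (intro mult_left_mono head) simp
    show "norm (of_real h * ((\<Sum>n<m. z n * (H (s n) - H 0)) + (\<Sum>n=M..<P. z n * H (s n))))
        \<le> h * (real m * (L * (real m / N)) + real m * (L * (real m / N)))"
      unfolding norm_mult norm_of_real using h0
      by (intro mult_mono order_trans[OF norm_triangle_ineq] add_mono start last) auto
    show "norm (of_real h * (\<Sum>n=m..<M. z n * H (s n))) \<le> h * (N / (2 * real m) * L)"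
      unfolding norm_mult norm_of_real using h0 by (intro mult_mono mid) auto
  qed
  also have "h * (N / (2 * real m) * L) = L / (2 * (real m * h))"
    using hh h0 N m by (simp add: field_simps)
  also have "h * (real m * (L * (real m / N)) + real m * (L * (real m / N))) \<le> 2 * (L * T\<^sup>2 * h)"
  proof -
    have "h * (real m * (L * (real m / N)) + real m * (L * (real m / N))) = 2 * (real m * (L * (real m / N)) * h)"
      by (simp only: distrib_left mult_2) (simp only: mult_ac)
    then show ?thesis using m2 by argo
  qed
  finally show ?thesis by (simp add: z_def s_def)
qed

text \<open>The cut is placed at m of size R sqrt N, with R chosen before N. A large R makes both
  the Fresnel tail and the middle range smaller than r / 4; for this fixed R the remaining errors
  are O(1 / sqrt N).\<close>

lemma quadratic_sum_asymptotics:
  fixes H :: "real \<Rightarrow> complex"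
  assumes lip: "\<And>x y. x \<in> {0..1/2} \<Longrightarrow> y \<in> {0..1/2} \<Longrightarrow> norm (H x - H y) \<le> L * \<bar>x - y\<bar>"
    and H_half: "H (1/2) = 0"
  shows "(\<lambda>N::nat. of_real (1 / sqrt N)
      * (\<Sum>n<N div 2. cis (2 * pi * ((real n + 1/2)\<^sup>2 / N)) * H ((real n + 1/2) / N)))
    \<longlonglongrightarrow> H 0 * (cis (pi / 4) / of_real (2 * sqrt 2))"
proof (rule LIMSEQ_I)
  fix r :: real assume r: "r > 0"
  obtain G :: "real \<Rightarrow> complex" where
    G: "\<And>x. (G has_vector_derivative cis (2 * pi * x\<^sup>2)) (at x)" "G 0 = 0"
    and limG: "(G \<longlongrightarrow> cis (pi / 4) / of_real (2 * sqrt 2)) at_top"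
    using fresnel_primitive by blast
  define C :: complex where "C = cis (pi / 4) / of_real (2 * sqrt 2)"
  have "((\<lambda>x. norm (H 0 * G x - H 0 * C)) \<longlongrightarrow> 0) at_top"
    using tendsto_mult_left[OF limG, of "H 0"] unfolding C_def[symmetric]
    by (simp add: tendsto_norm_zero_iff LIM_zero)
  then have "\<forall>\<^sub>F x in at_top. norm (H 0 * G x - H 0 * C) < r / 4"
    using r by (intro order_tendstoD) auto
  moreover have "((\<lambda>x. L / (2 * x)) \<longlongrightarrow> 0) at_top" by real_asymp
  then have "\<forall>\<^sub>F x in at_top. L / (2 * x) < r / 4"
    using r by (intro order_tendstoD) auto
  ultimately have "\<forall>\<^sub>F x in at_top. norm (H 0 * G x - H 0 * C) < r / 4 \<and> L / (2 * x) < r / 4"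
    by eventually_elim simp
  then obtain R0 where R0: "\<And>x. x \<ge> R0 \<Longrightarrow> norm (H 0 * G x - H 0 * C) < r / 4 \<and> L / (2 * x) < r / 4"
    by (auto simp: eventually_at_top_linorder)
  define R where "R = max R0 1"
  have R: "R \<ge> 1" "R \<ge> R0" by (auto simp: R_def)
  \<comment> \<open>Rounding \<open>R * sqrt N\<close> up to the integer \<open>m\<close> raises
    \<open>m * h\<close> above R by at most 1 / sqrt N, hence by at most 1.\<close>
  define T where "T = R + 1"
  define K where "K = norm (H 0) * (4 * pi * T\<^sup>2) + 2 * (L * T\<^sup>2)"
  have "(\<lambda>N::nat. K * (1 / sqrt N)) \<longlonglongrightarrow> 0" by real_asymp
  then have "\<forall>\<^sub>F N::nat in at_top. K * (1 / sqrt N) < r / 4"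
    using r by (intro order_tendstoD) auto
  \<comment> \<open>Guarantees \<open>2 * m \<le> N div 2\<close>, so that the two end blocks do not
    overlap; the added and subtracted 1 absorb the two roundings.\<close>
  moreover have "\<forall>\<^sub>F N::nat in at_top. 2 * (R * sqrt N + 1) \<le> N / 2 - 1" 
    by real_asymp
  moreover have "\<forall>\<^sub>F N::nat in at_top. N > 0" by (rule eventually_gt_at_top)
  ultimately have "\<forall>\<^sub>F N::nat in at_top. norm (of_real (1 / sqrt N)
      * (\<Sum>n<N div 2. cis (2 * pi * ((real n + 1/2)\<^sup>2 / N)) * H ((real n + 1/2) / N)) - H 0 * C) < r"
  proof eventually_elim
    case (elim N)
    define h where "h = 1 / sqrt N"
    define m where "m = nat \<lceil>R * sqrt N\<rceil>"
    have h0: "h > 0" using elim by (simp add: h_def)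
    have sq: "sqrt N \<ge> 1" using elim by simp
    have m1: "real m \<ge> R * sqrt N" unfolding m_def by (rule real_nat_ceiling_ge)
    have m2: "real m \<le> R * sqrt N + 1"
      unfolding m_def using R(1) by (simp add: of_nat_nat)
    have "R * sqrt N > 0" using R elim by simp
    then have m0: "m > 0" using m1 by linarith
    have "2 * real m \<le> real N / 2 - 1" using m2 elim by argo
    then have mP: "2 * m \<le> N div 2" by linarith
    have mh: "real m * h \<ge> R" using m1 sq by (simp add: h_def field_simps)
    have mT: "real m * h \<le> T"
    proof -
      have "real m * h \<le> (R * sqrt N + 1) * h" using m2 h0 by (intro mult_right_mono) auto
      also have "\<dots> = R + 1 / sqrt N" using sq by (simp add: h_def field_simps)
      also have "\<dots> \<le> T" using sq by (simp add: T_def)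
      finally show ?thesis .
    qed
    let ?S = "of_real h * (\<Sum>n<N div 2. cis (2 * pi * ((real n + 1/2)\<^sup>2 / N)) * H ((real n + 1/2) / N))"
    have "norm (?S - H 0 * G (real m * h)) \<le> norm (H 0) * (4 * pi * T\<^sup>2 * h) + 2 * (L * T\<^sup>2 * h) + L / (2 * (real m * h))"
      by (rule quadratic_sum_split_bound[OF lip H_half G m0 mP refl h_def mT])
    also have "\<dots> = K * (1 / sqrt N) + L / (2 * (real m * h))"
      by (simp add: K_def h_def algebra_simps)
    finally have "norm (?S - H 0 * G (real m * h)) < r / 4 + r / 4"
      using R0[of "real m * h"] mh R elim by argo
    moreover have "norm (H 0 * G (real m * h) - H 0 * C) < r / 4"
      using R0[of "real m * h"] mh R by linarith
    ultimately have "norm ((?S - H 0 * G (real m * h)) + (H 0 * G (real m * h) - H 0 * C)) < r"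
      using r by (intro order_le_less_trans[OF norm_triangle_ineq]) linarith
    then show ?case by (simp add: h_def)
  qed
  then show "\<exists>no. \<forall>N\<ge>no. norm (of_real (1 / sqrt (real N))
      * (\<Sum>n<N div 2. cis (2 * pi * ((real n + 1/2)\<^sup>2 / N)) * H ((real n + 1/2) / N))
      - H 0 * (cis (pi / 4) / of_real (2 * sqrt 2))) < r"
    by (simp add: eventually_at_top_linorder C_def)
qed

text \<open>For odd \<open>N\<close> the middle index is its own mirror image and belongs to no
  pair, hence the assumption that its term vanishes.\<close>

lemma sum_pair_symmetric:
  fixes f :: "nat \<Rightarrow> 'a :: comm_monoid_add"
  assumes "odd N \<Longrightarrow> f (N div 2) = 0"
  shows "(\<Sum>j<N. f j) = (\<Sum>n<N div 2. f n + f (N - 1 - n))"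
proof -
  define P where "P = N div 2"
  have P: "P \<le> N - P" "N - P \<le> N" by (auto simp: P_def)
  have upper: "(\<Sum>j=N - P..<N. f j) = (\<Sum>n<P. f (N - 1 - n))"
    using P by (intro sum.reindex_bij_witness[of _ "\<lambda>n. N - 1 - n" "\<lambda>j. N - 1 - j"]) auto
  have mid: "(\<Sum>j=P..<N - P. f j) = 0"
  proof (cases "odd N")
    case True
    then have "{P..<N - P} = {P}" by (auto simp: P_def elim!: oddE)
    then show ?thesis using assms[OF True] by (simp add: P_def)
  next
    case False
    then show ?thesis by (auto simp: P_def elim!: evenE)
  qed
  have "(\<Sum>j<N. f j) = (\<Sum>j<P. f j) + (\<Sum>j=P..<N - P. f j) + (\<Sum>j=N - P..<N. f j)"
    using P by (simp add: lessThan_atLeast0 sum.atLeastLessThan_concat)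
  also have "\<dots> = (\<Sum>j<P. f j + f (N - 1 - j))"
    by (simp only: upper mid sum.distrib add_0_right)
  finally show ?thesis by (simp only: P_def)
qed

section \<open>Morton's formula as a quadratic exponential sum\<close>

text \<open>The bound on t keeps \<open>\<i> * of_real t\<close> in the strip where
  \<open>Ln\<close> inverts \<open>exp\<close>, so the principal power is the intended one.\<close>

lemma exp_powr_of_real:
  assumes "\<bar>t\<bar> < pi"
  shows "exp (\<i> * of_real t) powr of_real s = cis (s * t)"
proof -
  have "Ln (exp (\<i> * of_real t)) = \<i> * of_real t"
    using assms by (intro Ln_exp) auto
  then show ?thesis by (simp add: powr_def cis_conv_exp mult_ac)
qed

text \<open>The shift \<open>\<epsilon>\<close> carries the term 1/2 in the exponents of Morton's formula.\<close>

definition torus_amplitude :: "int \<Rightarrow> int \<Rightarrow> real \<Rightarrow> real \<Rightarrow> complex" where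
  "torus_amplitude a b \<epsilon> x = cis (2 * pi * x / a)
     * (cis (2 * pi * x / b + \<epsilon>) - cis (- (2 * pi * x / b + \<epsilon>)))"

text \<open>At this q the factor a b cancels from the quadratic exponent, leaving the phase k^2 / N.
  The shift k = s - N/2 produces a constant phase \<open>cis (pi * N / 2)\<close>, which cancels
  against the prefactor of the formula, and the overall minus sign.\<close>

lemma colored_Jones_torus_root_of_unity:
  fixes a b :: int and N :: nat
  assumes "a > 2" "b > 2" "N > 0"
  shows "colored_Jones_torus a b N (exp (2 * complex_of_real pi * \<i> / (of_int a * of_int b * of_nat N)))
    = - cis (pi / (2 * real N)) / (2 * \<i> * of_real (sin (pi / (real_of_int a * real_of_int b))))
      * (\<Sum>j<N. cis (2 * pi * ((real j + 1/2)\<^sup>2 / N))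
          * torus_amplitude a b (pi / (real_of_int a * real_of_int b * N)) ((real j + 1/2) / N - 1/2))"
proof -
  define A B D where "A = real_of_int a" and "B = real_of_int b" and "D = A * B * real N"
  have AB: "A > 2" "B > 2" using assms by (auto simp: A_def B_def)
  have "A * B > 2 * 2" using AB by (intro mult_strict_mono) auto
  then have AB4: "A * B > 4" by simp
  have N: "real N \<ge> 1" using assms by simp
  have "A * B * 1 \<le> A * B * real N" using AB4 N by (intro mult_left_mono) auto
  then have D: "D > 4" using AB4 by (simp add: D_def)
  define t where "t = 2 * pi / D"
  have "t < pi" using D by (simp add: t_def field_simps)
  moreover have "t > 0" using D by (simp add: t_def)
  ultimately have t: "\<bar>t\<bar> < pi" by simp
  define q where "q = exp (\<i> * of_real t)"
  have q: "exp (2 * complex_of_real pi * \<i> / (of_int a * of_int b * of_nat N)) = q"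
    by (simp add: q_def t_def D_def A_def B_def mult_ac)
  have powr: "q powr of_real s = cis (s * t)" for s
    unfolding q_def by (rule exp_powr_of_real[OF t])
  have pre: "q powr (- (of_int a * of_int b * ((of_nat N)\<^sup>2 - 1) / 4)) = cis (pi / (2 * N)) * cis (- (pi * N / 2))"
  proof -
    have "- (of_int a * of_int b * ((of_nat N)\<^sup>2 - 1) / 4) = complex_of_real (- (A * B * ((real N)\<^sup>2 - 1) / 4))"
      by (simp add: A_def B_def)
    moreover have "- (A * B * ((real N)\<^sup>2 - 1) / 4) * t = pi / (2 * N) - pi * N / 2"
      using AB N by (simp add: t_def D_def field_simps power2_eq_square)
    ultimately show ?thesis by (simp only: powr cis_mult) (simp add: algebra_simps)
  qed
  have den: "q powr (of_nat N / 2) - q powr (- (of_nat N / 2)) = 2 * \<i> * of_real (sin (pi / (A * B)))"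
  proof -
    have "of_nat N / 2 = complex_of_real (N / 2)" "- (of_nat N / 2) = complex_of_real (- (N / 2))"
      by simp_all
    moreover have "N / 2 * t = pi / (A * B)" "- (N / 2) * t = - (pi / (A * B))"
      using AB N by (simp_all add: t_def D_def)
    ultimately have "q powr (of_nat N / 2) - q powr (- (of_nat N / 2)) = cis (pi / (A * B)) - cis (- (pi / (A * B)))"
      by (simp only: powr)
    then show ?thesis by (simp add: complex_eq_iff)
  qed
  have summand: "(let k = of_nat j - (of_nat N - 1) / 2 in
          q powr (of_int a * of_int b * k\<^sup>2 + of_int b * k)
            * (q powr (of_int a * k + 1 / 2) - q powr (- (of_int a * k) - 1 / 2)))
     = - cis (pi * N / 2) * (cis (2 * pi * ((real j + 1/2)\<^sup>2 / N))
        * torus_amplitude a b (pi / D) ((real j + 1/2) / N - 1/2))" for j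
  proof -
    define s where "s = real j + 1/2"
    define k where "k = s - N / 2"
    have k: "of_nat j - (of_nat N - 1) / 2 = complex_of_real k"
      by (simp add: k_def s_def field_simps)
    have 1: "of_int a * of_int b * (complex_of_real k)\<^sup>2 + of_int b * complex_of_real k = complex_of_real (A * B * k\<^sup>2 + B * k)"
      and 2: "of_int a * complex_of_real k + 1 / 2 = complex_of_real (A * k + 1 / 2)"
      and 3: "- (of_int a * complex_of_real k) - 1 / 2 = complex_of_real (- (A * k + 1 / 2))"
      by (simp_all add: A_def B_def)
    have x: "k / N = s / N - 1/2" using N by (simp add: k_def field_simps)
    have e1: "(A * B * k\<^sup>2 + B * k) * t = 2 * pi * (k\<^sup>2 / N) + 2 * pi * (k / N) / A"
      and e2: "(A * k + 1 / 2) * t = 2 * pi * (k / N) / B + pi / D"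
      and e3: "- (A * k + 1 / 2) * t = - (2 * pi * (k / N) / B + pi / D)"
      using AB N by (simp_all add: t_def D_def field_simps power2_eq_square)
    \<comment> \<open>Expanding the square leaves the linear term - 2 pi s; as s = j + 1/2, it is -
      pi up to a multiple of 2 pi, whence the sign.\<close>
    have "2 * pi * (k\<^sup>2 / N) = 2 * pi * (s\<^sup>2 / N) + (pi * N / 2) - pi - 2 * pi * j"
      using N by (simp add: k_def s_def field_simps power2_eq_square)
    then have "cis (2 * pi * (k\<^sup>2 / N)) = cis (2 * pi * (s\<^sup>2 / N)) * cis (pi * N / 2) / cis pi / cis (2 * pi * j)"
      by (simp only: cis_mult cis_divide)
    also have "cis (2 * pi * j) = 1" by (rule cis_multiple_2pi) simp
    finally have "cis (2 * pi * (k\<^sup>2 / N)) = - cis (pi * N / 2) * cis (2 * pi * (s\<^sup>2 / N))" by simp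
    then show ?thesis
      unfolding k Let_def 1 2 3 powr e1 e2 e3 s_def[symmetric] x[symmetric] torus_amplitude_def
      by (simp add: A_def B_def flip: cis_mult)
  qed
  have "cis (- (pi * N / 2)) * cis (pi * N / 2) = 1" by (simp add: cis_mult)
  then show ?thesis
    unfolding q colored_Jones_torus_def pre den summand sum_distrib_left[symmetric]
    by (simp add: A_def B_def D_def)
qed

section \<open>Regularity of the weight and the asymptotics of the sum\<close>

text \<open>As a difference of two pure exponentials the weight has a Lipschitz constant that can be
  read off from the two frequencies.\<close>

lemma torus_amplitude_alt:
  "torus_amplitude a b 0 x = cis ((2 * pi / a + 2 * pi / b) * x) - cis ((2 * pi / a - 2 * pi / b) * x)"
  by (simp add: torus_amplitude_def algebra_simps cis_mult add_divide_distrib diff_divide_distrib)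

lemma torus_amplitude_lipschitz:
  "norm (torus_amplitude a b 0 x - torus_amplitude a b 0 y)
    \<le> (\<bar>2 * pi / a + 2 * pi / b\<bar> + \<bar>2 * pi / a - 2 * pi / b\<bar>) * \<bar>x - y\<bar>"
proof -
  let ?u = "2 * pi / a + 2 * pi / b" and ?v = "2 * pi / a - 2 * pi / b"
  have "torus_amplitude a b 0 x - torus_amplitude a b 0 y
      = (cis (?u * x) - cis (?u * y)) - (cis (?v * x) - cis (?v * y))"
    unfolding torus_amplitude_alt by simp
  also have "norm \<dots> \<le> \<bar>?u * x - ?u * y\<bar> + \<bar>?v * x - ?v * y\<bar>"
    by (intro order_trans[OF norm_triangle_ineq4] add_mono norm_cis_diff_le)
  also have "\<dots> = (\<bar>?u\<bar> + \<bar>?v\<bar>) * \<bar>x - y\<bar>"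
  proof -
    have "\<bar>w * x - w * y\<bar> = \<bar>w\<bar> * \<bar>x - y\<bar>" for w
      by (simp add: abs_mult flip: right_diff_distrib)
    then show ?thesis by (simp only:) (rule distrib_right[symmetric])
  qed
  finally show ?thesis .
qed

text \<open>Allows the shift to be dropped: with \<open>\<epsilon>\<close> of order 1 / N, a sum of
  N terms changes by O(1), which is negligible against sqrt N.\<close>

lemma torus_amplitude_perturb:
  "norm (torus_amplitude a b \<epsilon> x - torus_amplitude a b 0 x) \<le> 2 * \<bar>\<epsilon>\<bar>"
proof -
  let ?y = "2 * pi * x / b"
  have "torus_amplitude a b \<epsilon> x - torus_amplitude a b 0 x
     = cis (2 * pi * x / a) * ((cis (?y + \<epsilon>) - cis ?y) - (cis (- (?y + \<epsilon>)) - cis (- ?y)))"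
    by (simp add: torus_amplitude_def algebra_simps)
  also have "norm \<dots> \<le> \<bar>(?y + \<epsilon>) - ?y\<bar> + \<bar>- (?y + \<epsilon>) - (- ?y)\<bar>"
    unfolding norm_mult norm_cis mult_1_left
    by (intro order_trans[OF norm_triangle_ineq4] add_mono norm_cis_diff_le)
  finally show ?thesis by simp
qed

lemma torus_sum_asymptotics:
  fixes a b :: int and \<epsilon> :: "nat \<Rightarrow> real"
  assumes \<epsilon>: "\<And>N. N > 0 \<Longrightarrow> \<bar>\<epsilon> N\<bar> \<le> K / real N"
  shows "(\<lambda>N::nat. of_real (1 / sqrt N) * (\<Sum>j<N. cis (2 * pi * ((real j + 1/2)\<^sup>2 / N))
          * torus_amplitude a b (\<epsilon> N) ((real j + 1/2) / N - 1/2)))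
      \<longlonglongrightarrow> - 4 * of_real (sin (pi / a) * sin (pi / b)) * (cis (pi / 4) / of_real (2 * sqrt 2))"
proof -
  define F where "F = torus_amplitude a b 0"
  define H where "H x = F (x - 1/2) + F (1/2 - x)" for x
  define z where "z N j = cis (2 * pi * ((real j + 1/2)\<^sup>2 / real N))" for N j
  define x where "x N j = (real j + 1/2) / real N" for N j
  define L where "L = \<bar>2 * pi / a + 2 * pi / b\<bar> + \<bar>2 * pi / a - 2 * pi / b\<bar>"
  have F0: "F 0 = 0" by (simp add: F_def torus_amplitude_def)
  \<comment> \<open>\<open>F (1/2)\<close> is \<open>2 * \<i> * sin (pi / b) * cis (pi / a)\<close>
    and \<open>F (- 1/2)\<close> is its conjugate, so \<open>H 0\<close> is twice a real
    part.\<close>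
  have H0: "H 0 = - 4 * of_real (sin (pi / a) * sin (pi / b))"
    by (simp add: H_def F_def torus_amplitude_def complex_eq_iff)
  have pair: "(\<Sum>j<N. z N j * F (x N j - 1/2)) = (\<Sum>n<N div 2. z N n * H (x N n))" for N
  proof (subst sum_pair_symmetric)
    assume "odd N"
    then obtain l where "N = 2 * l + 1" by (elim oddE)
    then have "x N (N div 2) - 1/2 = 0" by (simp add: x_def field_simps)
    then show "z N (N div 2) * F (x N (N div 2) - 1/2) = 0" by (simp only: F0) simp
  next
    show "(\<Sum>n<N div 2. z N n * F (x N n - 1/2) + z N (N - 1 - n) * F (x N (N - 1 - n) - 1/2))
        = (\<Sum>n<N div 2. z N n * H (x N n))"
    proof (rule sum.cong[OF refl])
      fix n assume "n \<in> {..<N div 2}"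
      then have n: "n < N" by auto
      then have r: "real (N - 1 - n) + 1/2 = N - (real n + 1/2)" by (simp add: of_nat_diff)
      \<comment> \<open>Reflection s to N - s changes s^2 / N by N - 2 s, an integer because 2 s = 2
        n + 1; the mirrored terms thus carry the same phase.\<close>
      have "2 * pi * ((real (N - 1 - n) + 1/2)\<^sup>2 / N)
          = 2 * pi * ((real n + 1/2)\<^sup>2 / N) + 2 * pi * (real N - 2 * real n - 1)"
        unfolding r using n by (simp add: field_simps power2_eq_square)
      moreover have "cis (2 * pi * (real N - 2 * real n - 1)) = 1"
        by (rule cis_multiple_2pi) auto
      ultimately have "z N (N - 1 - n) = z N n"
        by (simp add: z_def flip: cis_mult)
      moreover have "x N (N - 1 - n) - 1/2 = 1/2 - x N n"
        unfolding x_def r using n by (simp add: field_simps)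
      ultimately show "z N n * F (x N n - 1/2) + z N (N - 1 - n) * F (x N (N - 1 - n) - 1/2) = z N n * H (x N n)"
        by (simp add: H_def distrib_left)
    qed
  qed
  have "(\<lambda>N::nat. of_real (1 / sqrt N) * (\<Sum>n<N div 2. z N n * H (x N n)))
      \<longlonglongrightarrow> H 0 * (cis (pi / 4) / of_real (2 * sqrt 2))"
    unfolding z_def x_def
  proof (rule quadratic_sum_asymptotics)
    fix x y :: real
    have "H x - H y = (F (x - 1/2) - F (y - 1/2)) + (F (1/2 - x) - F (1/2 - y))"
      by (simp add: H_def)
    also have "norm \<dots> \<le> L * \<bar>(x - 1/2) - (y - 1/2)\<bar> + L * \<bar>(1/2 - x) - (1/2 - y)\<bar>"
      unfolding F_def L_def by (intro order_trans[OF norm_triangle_ineq] add_mono torus_amplitude_lipschitz)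
    also have "\<dots> = (2 * L) * \<bar>x - y\<bar>" by (simp add: abs_minus_commute)
    finally show "norm (H x - H y) \<le> (2 * L) * \<bar>x - y\<bar>" .
  qed (simp add: H_def F0)
  then have main: "(\<lambda>N::nat. of_real (1 / sqrt N) * (\<Sum>j<N. z N j * F (x N j - 1/2)))
      \<longlonglongrightarrow> H 0 * (cis (pi / 4) / of_real (2 * sqrt 2))"
    by (simp only: pair)
  let ?d = "\<lambda>N j. torus_amplitude a b (\<epsilon> N) (x N j - 1/2) - F (x N j - 1/2)"
  have "(\<lambda>N::nat. of_real (1 / sqrt N) * (\<Sum>j<N. z N j * ?d N j)) \<longlonglongrightarrow> 0"
  proof (rule Lim_null_comparison)
    show "(\<lambda>N::nat. 2 * K / sqrt N) \<longlonglongrightarrow> 0" by real_asymp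
    show "\<forall>\<^sub>F N in at_top. norm (of_real (1 / sqrt (real N)) * (\<Sum>j<N. z N j * ?d N j)) \<le> 2 * K / sqrt (real N)"
      using eventually_gt_at_top[of 0]
    proof eventually_elim
      case (elim N)
      have "norm (\<Sum>j<N. z N j * ?d N j) \<le> (\<Sum>j<N. 2 * (K / real N))"
      proof (rule sum_norm_le)
        fix j
        have "norm (?d N j) \<le> 2 * \<bar>\<epsilon> N\<bar>" unfolding F_def by (rule torus_amplitude_perturb)
        with \<epsilon>[OF elim] show "norm (z N j * ?d N j) \<le> 2 * (K / real N)"
          by (simp add: norm_mult z_def)
      qed
      also have "\<dots> = 2 * K" using elim by simp
      finally have "norm (\<Sum>j<N. z N j * ?d N j) \<le> 2 * K" .
      then have "1 / sqrt N * norm (\<Sum>j<N. z N j * ?d N j) \<le> 1 / sqrt N * (2 * K)"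
        by (intro mult_left_mono) auto
      then show ?case by (simp add: norm_mult norm_divide)
    qed
  qed
  from tendsto_add[OF main this] show ?thesis
    by (simp only: right_diff_distrib sum_subtractf add_0_right add_diff_cancel_left' diff_add_cancel
        add_diff_eq H0 flip: z_def x_def)
qed

section \<open>Asymptotics of the colored Jones polynomial\<close>

theorem theorem1p2:
  fixes a b :: int
  assumes "coprime a b" and "a > 2" and "b > 2"
  shows "(\<lambda>N::nat. colored_Jones_torus a b N
            (exp (2 * complex_of_real pi * \<i> / (of_int a * of_int b * of_nat N))))
         \<sim>[at_top]
         (\<lambda>N::nat. exp (- (complex_of_real pi * \<i> / 4))
            * complex_of_real (sin (pi / of_int a) * sin (pi / of_int b)
                 / (sqrt 2 * sin (pi / (of_int a * of_int b))))
            * complex_of_real (sqrt (real N)))"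
proof -
  define A B where "A = real_of_int a" and "B = real_of_int b"
  have AB: "A > 2" "B > 2" using assms by (auto simp: A_def B_def)
  have "A * B > 2 * 2" using AB by (intro mult_strict_mono) auto
  then have AB4: "A * B > 4" by simp
  have sin_pos: "sin (pi / x) > 0" if "x > 2" for x
    using that by (intro sin_gt_zero) (auto simp: field_simps)
  define s1 s2 s0 where "s1 = sin (pi / A)" and "s2 = sin (pi / B)" and "s0 = sin (pi / (A * B))"
  have s: "s1 > 0" "s2 > 0" "s0 > 0"
    unfolding s1_def s2_def s0_def using AB AB4 by (auto intro!: sin_pos)
  define S where "S N = (\<Sum>j<N. cis (2 * pi * ((real j + 1/2)\<^sup>2 / N))
      * torus_amplitude a b (pi / (A * B * N)) ((real j + 1/2) / N - 1/2))" for N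
  define c where "c = cis (- (pi / 4)) * of_real (s1 * s2 / (sqrt 2 * s0))"
  have c0: "c \<noteq> 0" using s by (simp add: c_def)
  have lim_S: "(\<lambda>N. of_real (1 / sqrt (real N)) * S N) \<longlonglongrightarrow> - 4 * of_real (s1 * s2) * (cis (pi / 4) / of_real (2 * sqrt 2))"
    unfolding S_def s1_def s2_def A_def B_def
  proof (rule torus_sum_asymptotics)
    fix N :: nat assume "N > 0"
    then show "\<bar>pi / (real_of_int a * real_of_int b * real N)\<bar> \<le> (pi / (A * B)) / real N"
      using assms by (simp add: A_def B_def)
  qed
  have lim_pre: "(\<lambda>N. - cis (pi / (2 * real N)) / (2 * \<i> * of_real s0)) \<longlonglongrightarrow> - cis 0 / (2 * \<i> * of_real s0)"
  proof (intro tendsto_intros)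
    show "(\<lambda>N. pi / (2 * real N)) \<longlonglongrightarrow> 0" by real_asymp
  qed (use s in auto)
  have "(\<lambda>N. - cis (pi / (2 * real N)) / (2 * \<i> * of_real s0) * (of_real (1 / sqrt (real N)) * S N) / c)
      \<longlonglongrightarrow> - cis 0 / (2 * \<i> * of_real s0) * (- 4 * of_real (s1 * s2) * (cis (pi / 4) / of_real (2 * sqrt 2))) / c"
    by (rule tendsto_divide[OF tendsto_mult[OF lim_pre lim_S] tendsto_const c0])
  also have "- cis 0 / (2 * \<i> * of_real s0) * (- 4 * of_real (s1 * s2) * (cis (pi / 4) / of_real (2 * sqrt 2))) / c = 1"
  proof -
    \<comment> \<open>The factor i cancels against the denominator 2 i s0, which turns the Fresnel
      phase pi / 4 into the phase - pi / 4 of the claim.\<close>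
    have "cis (pi / 4) = \<i> * cis (- (pi / 4))"
      by (simp add: complex_eq_iff cos_45 sin_45)
    then show ?thesis using s by (simp add: c_def field_simps)
  qed
  finally have lim: "(\<lambda>N. - cis (pi / (2 * real N)) / (2 * \<i> * of_real s0) * (of_real (1 / sqrt (real N)) * S N) / c) \<longlonglongrightarrow> 1" .
  have "exp (- (complex_of_real pi * \<i> / 4)) = cis (- (pi / 4))"
    by (simp add: cis_conv_exp mult.commute)
  then have c: "exp (- (complex_of_real pi * \<i> / 4))
            * complex_of_real (sin (pi / of_int a) * sin (pi / of_int b)
                 / (sqrt 2 * sin (pi / (of_int a * of_int b)))) = c"
    by (simp add: c_def s0_def s1_def s2_def A_def B_def)
  show ?thesis
    unfolding c
  proof (rule asymp_equivI', rule Lim_transform_eventually[OF lim])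
    \<comment> \<open>The closed form is available for N > 0 only, so the two quotients are compared
      eventually.\<close>
    show "\<forall>\<^sub>F N in at_top. - cis (pi / (2 * real N)) / (2 * \<i> * of_real s0) * (of_real (1 / sqrt (real N)) * S N) / c
       = colored_Jones_torus a b N (exp (2 * complex_of_real pi * \<i> / (of_int a * of_int b * of_nat N)))
          / (c * of_real (sqrt (real N)))"
      using eventually_gt_at_top[of 0]
    proof eventually_elim
      case (elim N)
      show ?case
        unfolding colored_Jones_torus_root_of_unity[OF assms(2,3) elim]
        by (simp add: S_def s0_def A_def B_def)
    qed
  qed
qed

end
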